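(* There exists an inter-class orthogonal plan for a $3^5$ experiment (with factors $A,B,C,D,E$) on eighteen blocks of size four each estimating all main effects and all two-factor interactions, except $DE^2$, which is confounded with the block factor.
   Context: $F=\{0,1,2\}$ is the field of order $3$. A run of a $3^m$ experiment is a vector $x\in F^m$ ($x_i$ is the level of the $i$th factor). A plan consists of a list of blocks, each a list of runs. For $a\in F^m\setminus\{0\}$, $E_a$ denotes the factorial effect given by $a$, with $E_a=E_{2a}$; run $x$ is at level $t$ of $E_a$ if $a'x=t$. With the factors named $A,B,C,D,E$ in this order, $E_a$ is also written $A^{a_1}B^{a_2}C^{a_3}D^{a_4}E^{a_5}$; thus $DE^2=E_{(0,0,0,1,2)'}$. $E_a$ is a main effect if $a$ has exactly one non-zero entry, and a two-factor interaction if $a$ has exactly two non-zero entries (so $DE$ and $DE^2$ count as two different two-factor interactions, each with 2 degrees of freedom). All interactions involving three or more factors are assumed absent. An effect is confounded with the block factor if within each block all runs are at the same level of that effect. Orthogonality through the block factor (all blocks of size $k$): $E_a$ and $E_b$ are orthogonal if $kN^{ab}=L^a(L^b)'$, where $N^{ab}$ has $(\alpha,\beta)$ entry the number of runs $x$ of the plan with $a'x=\alpha$, $b'x=\beta$, and $L^a$ has $(\alpha,j)$ entry the number of runs $x$ in block $j$ with $a'x=\alpha$. A plan is inter-class orthogonal if the set of all effects of interest (here: all main effects and two-factor interactions not confounded with the block factor) can be divided into several classes such that every effect is orthogonal (through the block factor) to every effect from a different class. A plan estimates a set $S$ of effects if, in the linear model in which the expected response of a run $x$ in block $j$ is $\mu+\beta_j+\sum_{E_a\in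 S}\theta^a_{a'x}$ (general effect, block effects, and effects of the levels of the members of $S$), every contrast $\sum_{t\in F} l_t\theta^a_t$ with $\sum_t l_t=0$, $E_a\in S$, is estimable. *)

theory Defs
  imports
    "HOL-Analysis.Finite_Cartesian_Product"
    "HOL-Library.Numeral_Type"
    "HOL-Library.Disjoint_Sets"
begin

text \<open>The field of order three is the numeral type \<^typ>\<open>3\<close>, whose arithmetic is
  arithmetic modulo 3. The factors are indexed by the finite type \<open>'m\<close>.\<close>

type_synonym 'm run = "3 ^ 'm"
type_synonym 'm plan = "'m run list list"

definition dot :: "3 ^ 'm::finite \<Rightarrow> 3 ^ 'm \<Rightarrow> 3" where
  "dot a x = (\<Sum>i\<in>UNIV. a $ i * x $ i)"

text \<open>The vectors \<open>a\<close> and \<open>2a\<close> give the same effect, so an effect is the set of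
  the two vectors representing it. Passing from \<open>a\<close> to \<open>2a\<close> only permutes the levels
  of the effect; the notions below are required for every choice of representatives,
  so none of them depends on a normalisation.\<close>

type_synonym 'm effect = "(3 ^ 'm) set"

definition effect :: "3 ^ 'm::finite \<Rightarrow> 'm effect" where
  "effect a = {a, 2 *s a}"

definition main_effects :: "'m::finite effect set" where
  "main_effects = {effect a | a. card {i. a $ i \<noteq> 0} = 1}"

definition two_factor_interactions :: "'m::finite effect set" where
  "two_factor_interactions = {effect a | a. card {i. a $ i \<noteq> 0} = 2}"

definition confounded :: "'m::finite plan \<Rightarrow> 'm effect \<Rightarrow> bool" where
  "confounded P e \<longleftrightarrow> (\<forall>a\<in>e. \<forall>B\<in>set P. \<exists>t. \<forall>x\<in>set B. dot a x = t)"

definition N_entry :: "'m::finite plan \<Rightarrow> 3 ^ 'm \<Rightarrow> 3 ^ 'm \<Rightarrow> 3 \<Rightarrow> 3 \<Rightarrow> nat" where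
  "N_entry P a b \<alpha> \<beta> = length (filter (\<lambda>x. dot a x = \<alpha> \<and> dot b x = \<beta>) (concat P))"

definition L_entry :: "'m::finite plan \<Rightarrow> 3 ^ 'm \<Rightarrow> 3 \<Rightarrow> nat \<Rightarrow> nat" where
  "L_entry P a \<alpha> j = length (filter (\<lambda>x. dot a x = \<alpha>) (P ! j))"

text \<open>Orthogonality through the block factor, for blocks of common size \<open>k\<close>: the
  matrix identity \<open>k N = L L'\<close>, entry by entry.\<close>

definition orthogonal_through_blocks ::
    "nat \<Rightarrow> 'm::finite plan \<Rightarrow> 'm effect \<Rightarrow> 'm effect \<Rightarrow> bool" where
  "orthogonal_through_blocks k P e f \<longleftrightarrow>
     (\<forall>a\<in>e. \<forall>b\<in>f. \<forall>\<alpha> \<beta>.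
        k * N_entry P a b \<alpha> \<beta> = (\<Sum>j<length P. L_entry P a \<alpha> j * L_entry P b \<beta> j))"

definition effects_of_interest :: "'m::finite plan \<Rightarrow> 'm effect set" where
  "effects_of_interest P =
     {e \<in> main_effects \<union> two_factor_interactions. \<not> confounded P e}"

text \<open>At least two classes are required; with a single class the orthogonality
  condition would be vacuous. The classes of a partition are non-empty.\<close>

definition inter_class_orthogonal :: "nat \<Rightarrow> 'm::finite plan \<Rightarrow> bool" where
  "inter_class_orthogonal k P \<longleftrightarrow>
     (\<exists>\<C>. partition_on (effects_of_interest P) \<C> \<and> card \<C> \<ge> 2 \<and>
          (\<forall>X\<in>\<C>. \<forall>Y\<in>\<C>. X \<noteq> Y \<longrightarrow>
             (\<forall>e\<in>X. \<forall>f\<in>Y. orthogonal_through_blocks k P e f)))"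

text \<open>The linear model. The function \<open>r\<close> picks the representative of each effect by
  which its levels are labelled: \<open>\<theta> e t\<close> is the effect of the level \<open>t\<close> of \<open>e\<close>,
  i.e. of the runs \<open>x\<close> with \<open>dot (r e) x = t\<close>.\<close>

definition expected_response ::
    "'m::finite effect set \<Rightarrow> ('m effect \<Rightarrow> 3 ^ 'm) \<Rightarrow> real \<Rightarrow> (nat \<Rightarrow> real) \<Rightarrow>
     ('m effect \<Rightarrow> 3 \<Rightarrow> real) \<Rightarrow> nat \<Rightarrow> 'm run \<Rightarrow> real" where
  "expected_response S r \<mu> \<beta> \<theta> j x = \<mu> + \<beta> j + (\<Sum>e\<in>S. \<theta> e (dot (r e) x))"

text \<open>A function of the parameters is estimable if some linear combination of the
  responses is an unbiased estimator of it; \<open>c j i\<close> is the coefficient of the response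
  of the \<open>i\<close>-th run of block \<open>j\<close>.\<close>

definition estimable ::
    "'m::finite plan \<Rightarrow> 'm effect set \<Rightarrow> ('m effect \<Rightarrow> 3 ^ 'm) \<Rightarrow>
     (real \<Rightarrow> (nat \<Rightarrow> real) \<Rightarrow> ('m effect \<Rightarrow> 3 \<Rightarrow> real) \<Rightarrow> real) \<Rightarrow> bool" where
  "estimable P S r \<phi> \<longleftrightarrow>
     (\<exists>c :: nat \<Rightarrow> nat \<Rightarrow> real. \<forall>\<mu> \<beta> \<theta>.
        (\<Sum>j<length P. \<Sum>i<length (P ! j).
           c j i * expected_response S r \<mu> \<beta> \<theta> j (P ! j ! i)) = \<phi> \<mu> \<beta> \<theta>)"

definition estimates :: "'m::finite plan \<Rightarrow> 'm effect set \<Rightarrow> bool" where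
  "estimates P S \<longleftrightarrow>
     (\<forall>r. (\<forall>e\<in>S. r e \<in> e) \<longrightarrow>
        (\<forall>e\<in>S. \<forall>l :: 3 \<Rightarrow> real. (\<Sum>t\<in>UNIV. l t) = 0 \<longrightarrow>
           estimable P S r (\<lambda>\<mu> \<beta> \<theta>. \<Sum>t\<in>UNIV. l t * \<theta> e t)))"

text \<open>For a \<open>3\<^sup>5\<close> experiment the factors A, B, C, D, E are the elements
  1, 2, 3, 4, 5 of the index type \<^typ>\<open>5\<close> (in which \<open>5 = 0\<close>).\<close>

definition DE2 :: "5 effect" where
  "DE2 = effect (axis 4 1 + axis 5 2)"

end

theory Submission imports Defs begin

text \<open>The plan consists of two initial blocks together with all their translates under a
  subgroup \<open>H\<close> of order nine in \<open>F\<^sup>5\<close>, generated by \<open>h\<^sub>1 = (0,0,1,2,1)\<close> and \<open>h\<^sub>2 = (1,1,1,1,0)\<close>.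
  By translation invariance, effects whose vectors \<open>a\<close>, \<open>b\<close> do not restrict, up to sign, to the
  same functional on \<open>H\<close> are orthogonal through the block factor. The main effects and two-factor
  interactions thus fall into five classes, four of at most six effects and \<open>{AB\<^sup>2}\<close>.
  An effect in a class with non-zero functional needs one complex character sum over the
  eight initial runs, of which the two block constraints leave six dimensions. So, for suitable
  initial blocks, each class can be resolved by inverting an eight by eight matrix over the field
  of cube roots of unity; the inverses turn out to have very small entries and are tabulated.\<close>

section \<open>The field of order three and sums over its plane\<close>

lemma UNIV_three: "(UNIV :: 3 set) = {0, 1, 2}"
proof -
  have "x \<in> {0, 1, 2}" for x :: 3
  proof (induct x)
    case (of_int z)
    then have "z = 0 \<or> z = 1 \<or> z = 2" by auto
    then show ?case by auto
  qed
  then show ?thesis by auto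
qed

lemma three_cases: "x = 0 \<or> x = 1 \<or> x = 2" for x :: 3
  using UNIV_three by auto

lemma three_mult_eq_0 [simp]: "3 * x = (0 :: 3)"
  using three_cases[of x] by auto

lemma four_mult_eq [simp]: "4 * x = (x :: 3)"
  using three_cases[of x] by auto

lemma sum_three: "sum f (UNIV :: 3 set) = f 0 + f 1 + f 2"
  unfolding UNIV_three by (simp add: add.assoc)

lemma UNIV_five: "(UNIV :: 5 set) = {1, 2, 3, 4, 5}"
proof -
  have "x \<in> {1, 2, 3, 4, 5}" for x :: 5
  proof (induct x)
    case (of_int z)
    then have "z = 0 \<or> z = 1 \<or> z = 2 \<or> z = 3 \<or> z = 4" by auto
    then show ?case by auto
  qed
  then show ?thesis by auto
qed

lemma sum_five: "sum f (UNIV :: 5 set) = f 1 + f 2 + f 3 + f 4 + f 5"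
  unfolding UNIV_five by (simp add: add.assoc)

text \<open>A non-zero linear functional on \<open>F^2\<close> takes every value at exactly three
  points, and adding \<open>y\<close> only permutes the values.\<close>

lemma sum_affine_three:
  fixes f :: "3 \<Rightarrow> 'a::comm_semiring_1"
  assumes "(u, v) \<noteq> (0, 0)"
  shows "(\<Sum>p\<in>UNIV. \<Sum>q\<in>UNIV. f (y + (p * u + q * v))) = 3 * (\<Sum>t\<in>UNIV. f t)"
proof -
  have shift: "(\<Sum>t\<in>UNIV. f (y + t)) = (\<Sum>t\<in>UNIV. f t)"
    by (rule sum.reindex_bij_witness[where i = "\<lambda>t. t - y" and j = "\<lambda>t. y + t"]) auto
  have affine: "(\<Sum>p\<in>UNIV. \<Sum>q\<in>UNIV. g (p * u + q * v)) = 3 * (\<Sum>t\<in>UNIV. g t)"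
    for g :: "3 \<Rightarrow> 'a"
  proof -
    have reduce: "g 3 = g 0" "g 4 = g 1" "g 5 = g 2" "g 6 = g 0" "g 8 = g 2"
      by (rule arg_cong[of _ _ g]; simp)+
    have three: "3 * x = x + x + x" for x :: 'a
      using distrib_right[of 2 1 x] by (simp add: mult_2)
    show ?thesis
      using assms three_cases[of u] three_cases[of v]
      by (auto simp: sum_three reduce three add.assoc add.commute add.left_commute)
  qed
  show ?thesis
    using affine[of "\<lambda>t. f (y + t)"] shift by simp
qed

text \<open>Either one functional vanishes and its factor is constant, or the two are independent
  and serve as coordinates on \<open>F^2\<close>, so that the double sum splits.\<close>

lemma sum_independent_three:
  fixes f g :: "3 \<Rightarrow> 'a::comm_semiring_1"
  assumes "(u', v') \<noteq> (u, v)" "(u', v') \<noteq> (2 * u, 2 * v)"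
  shows "9 * (\<Sum>p\<in>UNIV. \<Sum>q\<in>UNIV. f (p * u + q * v) * g (p * u' + q * v'))
    = (\<Sum>p\<in>UNIV. \<Sum>q\<in>UNIV. f (p * u + q * v)) * (\<Sum>p\<in>UNIV. \<Sum>q\<in>UNIV. g (p * u' + q * v'))"
proof -
  \<comment> \<open>Over \<open>F\<close>, dependent non-zero functionals agree up to a factor 1 or
    2, which the hypotheses exclude.\<close>
  consider "(u, v) = (0, 0)" | "(u', v') = (0, 0)" | "u * v' - v * u' \<noteq> 0"
    using assms three_cases[of u] three_cases[of v] three_cases[of u'] three_cases[of v']
    by (elim disjE) simp_all
  then show ?thesis
  proof cases
    case 3
    define D where "D = u * v' - v * u'"
    have "D * D = 1"
      using 3 three_cases[of D] by (auto simp: D_def[symmetric])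
    then have inv: "D * (D * x) = x" for x
      by (simp flip: mult.assoc)
    have "(\<Sum>p\<in>UNIV. \<Sum>q\<in>UNIV. f (p * u + q * v) * g (p * u' + q * v'))
      = (\<Sum>(p, q)\<in>UNIV. f (p * u + q * v) * g (p * u' + q * v'))"
      by (simp add: sum.cartesian_product)
    also have "\<dots> = (\<Sum>(s, t)\<in>UNIV. f s * g t)"
    \<comment> \<open>The inverse map is Cramer's rule; the determinant \<open>D\<close> is 1 or 2,
      hence its own inverse.\<close>
    proof (rule sum.reindex_bij_witness[where
          i = "\<lambda>(s, t). (D * (v' * s - v * t), D * (u * t - u' * s))" and
          j = "\<lambda>(p, q). (p * u + q * v, p * u' + q * v')"], goal_cases)
      case (1 x)
      have "D * (v' * (p * u + q * v) - v * (p * u' + q * v')) = D * (D * p)"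
        "D * (u * (p * u' + q * v') - u' * (p * u + q * v)) = D * (D * q)" for p q
        by (simp_all add: D_def algebra_simps)
      then show ?case by (simp add: inv split: prod.split)
    next
      case (3 x)
      have "D * (v' * s - v * t) * u + D * (u * t - u' * s) * v = D * (D * s)"
        "D * (v' * s - v * t) * u' + D * (u * t - u' * s) * v' = D * (D * t)" for s t
        by (simp_all add: D_def algebra_simps)
      then show ?case by (simp add: inv split: prod.split)
    qed auto
    also have "\<dots> = (\<Sum>t\<in>UNIV. f t) * (\<Sum>t\<in>UNIV. g t)"
      by (simp add: sum_product sum.cartesian_product)
    finally have "(\<Sum>p\<in>UNIV. \<Sum>q\<in>UNIV. f (p * u + q * v) * g (p * u' + q * v'))
      = (\<Sum>t\<in>UNIV. f t) * (\<Sum>t\<in>UNIV. g t)" .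
    moreover have "(u, v) \<noteq> (0, 0)" "(u', v') \<noteq> (0, 0)"
      using 3 by auto
    ultimately show ?thesis
      using sum_affine_three[of u v f 0] sum_affine_three[of u' v' g 0]
      by (simp add: algebra_simps)
  qed (simp_all add: sum_distrib_left sum_distrib_right algebra_simps)
qed

section \<open>Reduction modulo three, linearity of \<open>dot\<close>, representatives of
  effects\<close>

lemma of_int_mod_three: "of_int (z mod 3) = (of_int z :: 3)"
proof -
  have "(of_int z :: 3) = of_int (z mod 3 + 3 * (z div 3))" by simp
  also have "\<dots> = of_int (z mod 3)" unfolding of_int_add of_int_mult by simp
  finally show ?thesis by simp
qed

lemma of_int_eq_iff_three: "(of_int x :: 3) = of_int y \<longleftrightarrow> x mod 3 = y mod 3"
proof
  have cases: "z mod 3 = 0 \<or> z mod 3 = 1 \<or> z mod 3 = 2" for z :: int by auto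
  assume "(of_int x :: 3) = of_int y"
  then have "(of_int (x mod 3) :: 3) = of_int (y mod 3)" by (simp add: of_int_mod_three)
  then show "x mod 3 = y mod 3" using cases[of x] cases[of y] by auto
qed (metis of_int_mod_three)

lemma dot_add: "dot a (x + y) = dot a x + dot a y"
  by (simp add: dot_def algebra_simps sum.distrib)

lemma dot_scale: "dot a (c *s x) = c * dot a x"
  by (simp add: dot_def sum_distrib_left algebra_simps)

lemma dot_scale_left: "dot (c *s a) x = c * dot a x"
  by (simp add: dot_def sum_distrib_left algebra_simps)

lemma effect_eq: "a \<in> effect b \<Longrightarrow> effect a = effect b"
proof -
  have "2 *s (2 *s b) = b" by (simp add: vec_eq_iff)
  then show "a \<in> effect b \<Longrightarrow> effect a = effect b"
    by (auto simp: effect_def)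
qed

section \<open>A sufficient condition for estimability\<close>

text \<open>It suffices to estimate, for each level \<open>s\<close>, the deviation of its effect
  from the mean over the levels: zero block sums cancel \<open>\<mu>\<close> and
  \<open>\<beta>\<close>, and in a contrast \<open>l\<close> the means cancel. \<open>F\<close>
  stands for the unknown \<open>\<theta> f\<close>, hence is arbitrary.\<close>

lemma estimatesI:
  fixes P :: "'m::finite plan"
  assumes "\<And>r e s. \<forall>f\<in>S. r f \<in> f \<Longrightarrow> e \<in> S \<Longrightarrow>
    \<exists>c :: nat \<Rightarrow> nat \<Rightarrow> real. (\<forall>j<length P. (\<Sum>i<length (P ! j). c j i) = 0) \<and>
      (\<forall>f\<in>S. \<forall>F. (\<Sum>j<length P. \<Sum>i<length (P ! j). c j i * F (dot (r f) (P ! j ! i)))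
         = (if f = e then F s - (\<Sum>t\<in>UNIV. F t) / 3 else 0))"
  shows "estimates P S"
  unfolding estimates_def estimable_def
proof (intro allI ballI impI)
  fix r e and l :: "3 \<Rightarrow> real"
  assume r: "\<forall>f\<in>S. r f \<in> f" and e: "e \<in> S" and l: "(\<Sum>t\<in>UNIV. l t) = 0"
  define good where "good s c \<longleftrightarrow> (\<forall>j<length P. (\<Sum>i<length (P ! j). c j i) = 0) \<and>
      (\<forall>f\<in>S. \<forall>F. (\<Sum>j<length P. \<Sum>i<length (P ! j). c j i * F (dot (r f) (P ! j ! i)))
         = (if f = e then F s - (\<Sum>t\<in>UNIV. F t) / 3 else 0))" for s and c :: "nat \<Rightarrow> nat \<Rightarrow> real"
  have "\<forall>s. \<exists>c. good s c"
    unfolding good_def using assms[OF r e] by blast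
  then obtain c where good: "\<And>s. good s (c s)"
    by metis
  have c0: "(\<Sum>i<length (P ! j). c s j i) = 0" if "j < length P" for s j
    using good[of s] that by (simp add: good_def)
  have c: "(\<Sum>j<length P. \<Sum>i<length (P ! j). c s j i * F (dot (r f) (P ! j ! i)))
      = (if f = e then F s - (\<Sum>t\<in>UNIV. F t) / 3 else 0)" if "f \<in> S" for s f F
    using good[of s] that unfolding good_def by blast
  have "(\<Sum>j<length P. \<Sum>i<length (P ! j).
      (\<Sum>s\<in>UNIV. l s * c s j i) * expected_response S r \<mu> \<beta> \<theta> j (P ! j ! i)) = (\<Sum>t\<in>UNIV. l t * \<theta> e t)"
    for \<mu> \<beta> \<theta>
  proof -
    have single: "(\<Sum>j<length P. \<Sum>i<length (P ! j). c s j i * expected_response S r \<mu> \<beta> \<theta> j (P ! j ! i))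
      = \<theta> e s - (\<Sum>t\<in>UNIV. \<theta> e t) / 3" for s
    proof -
      have "(\<Sum>j<length P. \<Sum>i<length (P ! j). c s j i * expected_response S r \<mu> \<beta> \<theta> j (P ! j ! i))
        = (\<Sum>j<length P. (\<Sum>i<length (P ! j). c s j i) * (\<mu> + \<beta> j))
          + (\<Sum>j<length P. \<Sum>i<length (P ! j). \<Sum>f\<in>S. c s j i * \<theta> f (dot (r f) (P ! j ! i)))"
        by (simp add: expected_response_def distrib_left sum.distrib sum_distrib_left sum_distrib_right)
      also have "(\<Sum>j<length P. (\<Sum>i<length (P ! j). c s j i) * (\<mu> + \<beta> j)) = 0"
        by (simp add: c0)
      also have "(\<Sum>j<length P. \<Sum>i<length (P ! j). \<Sum>f\<in>S. c s j i * \<theta> f (dot (r f) (P ! j ! i)))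
        = (\<Sum>f\<in>S. \<Sum>j<length P. \<Sum>i<length (P ! j). c s j i * \<theta> f (dot (r f) (P ! j ! i)))"
        by (simp add: sum.swap[of _ S])
      also have "\<dots> = (\<Sum>f\<in>S. if f = e then \<theta> f s - (\<Sum>t\<in>UNIV. \<theta> f t) / 3 else 0)"
        by (intro sum.cong refl c)
      finally show ?thesis using e by simp
    qed
    have "(\<Sum>j<length P. \<Sum>i<length (P ! j).
      (\<Sum>s\<in>UNIV. l s * c s j i) * expected_response S r \<mu> \<beta> \<theta> j (P ! j ! i))
      = (\<Sum>s\<in>UNIV. l s * (\<Sum>j<length P. \<Sum>i<length (P ! j). c s j i * expected_response S r \<mu> \<beta> \<theta> j (P ! j ! i)))"
      by (simp add: sum_distrib_left sum_distrib_right sum.swap[of _ UNIV] mult.assoc)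
    also have "\<dots> = (\<Sum>s\<in>UNIV. l s * \<theta> e s) - (\<Sum>s\<in>UNIV. l s) * ((\<Sum>t\<in>UNIV. \<theta> e t) / 3)"
      by (simp only: single right_diff_distrib sum_subtractf sum_distrib_right)
    finally show ?thesis using l by simp
  qed
  then show "\<exists>c. \<forall>\<mu> \<beta> \<theta>. (\<Sum>j<length P. \<Sum>i<length (P ! j).
      c j i * expected_response S r \<mu> \<beta> \<theta> j (P ! j ! i)) = (\<Sum>t\<in>UNIV. l t * \<theta> e t)"
    by (intro exI allI)
qed

section \<open>Integer lists as vectors\<close>

text \<open>Integer lists make the later finite checks computable. Index 5, which equals 0, falls
  into the last \<open>else\<close> and reads position 4.\<close>

definition vec5 :: "int list \<Rightarrow> 3 ^ 5" where
  "vec5 xs = (\<chi> i. of_int (xs ! (if i = 1 then 0 else if i = 2 then 1 else if i = 3 then 2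
     else if i = 4 then 3 else 4)))"

definition ldot :: "int list \<Rightarrow> int list \<Rightarrow> int" where
  "ldot xs ys = sum_list (map2 (*) xs ys)"

lemma length5E:
  assumes "length xs = 5" obtains a b c d e where "xs = [a, b, c, d, e]"
  using assms by (auto simp: eval_nat_numeral length_Suc_conv)

lemma dot_vec5:
  assumes "length xs = 5" "length ys = 5"
  shows "dot (vec5 xs) (vec5 ys) = of_int (ldot xs ys)"
  using assms by (elim length5E) (simp add: dot_def sum_five vec5_def ldot_def)

lemma vec5_exhaust:
  obtains xs where "xs \<in> set (List.n_lists 5 [0, 1, 2])" "a = vec5 xs"
proof -
  have "\<exists>z\<in>{0, 1, 2}. t = of_int z" for t :: 3
    using three_cases[of t] by auto
  then obtain z where z: "\<And>t. z t \<in> {0, 1, 2}" "\<And>t :: 3. of_int (z t) = t"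
    by metis
  define xs where "xs = [z (a $ 1), z (a $ 2), z (a $ 3), z (a $ 4), z (a $ 5)]"
  have "xs \<in> set (List.n_lists 5 [0, 1, 2])"
    unfolding set_n_lists using z(1) by (auto simp: xs_def)
  moreover have "a = vec5 xs"
    using UNIV_five by (auto simp: vec_eq_iff vec5_def xs_def z(2))
  ultimately show ?thesis using that by blast
qed

lemma card_support_vec5:
  assumes "xs \<in> set (List.n_lists 5 [0, 1, 2])"
  shows "card {i. vec5 xs $ i \<noteq> 0} = length (filter ((\<noteq>) 0) xs)"
proof -
  have len: "length xs = 5" and xs: "set xs \<subseteq> {0, 1, 2}"
    using assms by (auto simp: set_n_lists)
  have "card {i. vec5 xs $ i \<noteq> 0} = (\<Sum>i\<in>UNIV. if vec5 xs $ i \<noteq> 0 then 1 else 0)"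
    by (simp add: sum.If_cases)
  moreover have "(of_int z :: 3) = 0 \<longleftrightarrow> z = 0" if "z \<in> {0, 1, 2}" for z
    using that by auto
  ultimately show ?thesis
    using len xs by (elim length5E) (simp add: sum_five vec5_def)
qed

lemma scale_vec5: "length xs = 5 \<Longrightarrow> 2 *s vec5 xs = vec5 (map (\<lambda>x. 2 * x mod 3) xs)"
  by (elim length5E) (auto simp: vec_eq_iff vec5_def of_int_mod_three)

lemma DE2_eq: "DE2 = effect (vec5 [0, 0, 0, 1, 2])"
proof -
  have "axis 4 1 + axis 5 2 = vec5 [0, 0, 0, 1, 2]"
    using UNIV_five by (auto simp: vec_eq_iff vec5_def axis_def)
  then show ?thesis by (simp add: DE2_def)
qed

section \<open>The plan and sums over it\<close>

text \<open>The first four runs form one initial block, the last four the other. The levels of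
  \<open>D\<close> and \<open>E\<close> coincide in all eight, which puts them all at level 0 of
  \<open>DE2\<close>.\<close>

definition initial_runs :: "int list list" where
  "initial_runs = [[0,0,0,0,0], [0,0,2,1,1], [2,1,0,2,2], [0,1,2,1,1],
           [0,2,1,2,2], [0,2,2,1,1], [1,2,0,1,1], [0,1,2,1,1]]"

definition dir1 :: "int list" where "dir1 = [0,0,1,2,1]"
definition dir2 :: "int list" where "dir2 = [1,1,1,1,0]"

definition block :: "nat \<Rightarrow> 5 run list" where
  "block j = map (\<lambda>x. vec5 x + (of_nat j *s vec5 dir1 + of_nat (j div 3) *s vec5 dir2))
     (take 4 (drop (4 * (j div 9)) initial_runs))"

text \<open>As \<open>j\<close> runs through the nine indices with a given \<open>j div 9\<close>, the pair
  \<open>(j, j div 3)\<close> modulo 3 runs through \<open>F\<^sup>2\<close> exactly once.\<close>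

definition plan :: "5 plan" where
  "plan = map block [0..<18]"

text \<open>The functional on the translation group given by \<open>a\<close>, in terms of the two generators.\<close>

definition class_vec :: "3 ^ 5 \<Rightarrow> 3 \<times> 3" where
  "class_vec a = (dot a (vec5 dir1), dot a (vec5 dir2))"

lemma length_initial_runs [simp]: "length initial_runs = 8"
  by (simp add: initial_runs_def)

lemma length_plan [simp]: "length plan = 18"
  by (simp add: plan_def)

lemma length_plan_nth [simp]: "j < 18 \<Longrightarrow> length (plan ! j) = 4"
proof -
  assume "j < 18"
  moreover from this have "j div 9 \<le> 1" by linarith
  ultimately show ?thesis by (simp add: plan_def block_def)
qed

lemma dot_plan_nth:
  assumes "j < 18" "i < 4"
  shows "dot a (plan ! j ! i) = dot a (vec5 (initial_runs ! (4 * (j div 9) + i)))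
    + (of_nat j * fst (class_vec a) + of_nat (j div 3) * snd (class_vec a))"
proof -
  have "j div 9 \<le> 1" using assms by linarith
  then show ?thesis
    using assms by (simp add: plan_def block_def class_vec_def dot_add dot_scale)
qed

text \<open>Trades the block index for an initial block and a translation, so that counts over the
  plan become sums over the group; checked by writing out all eighteen terms.\<close>

lemma sum_blocks:
  "(\<Sum>j<18. f (j div 9) (of_nat j :: 3) (of_nat (j div 3) :: 3)) = (\<Sum>k<2. \<Sum>p\<in>UNIV. \<Sum>q\<in>UNIV. f k p q)"
  for f :: "nat \<Rightarrow> 3 \<Rightarrow> 3 \<Rightarrow> 'a::comm_monoid_add"
proof -
  have reduce: "(3::3) = 0" "(4::3) = 1" "(5::3) = 2" "(6::3) = 0" "(7::3) = 1" "(8::3) = 2" "(9::3) = 0"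
    "(10::3) = 1" "(11::3) = 2" "(12::3) = 0" "(13::3) = 1" "(14::3) = 2" "(15::3) = 0" "(16::3) = 1" "(17::3) = 2"
    by simp_all
  have upt: "[0..<18] = [0, 1, 2, 3, 4, 5, 6, 7, 8, 9, 10, 11, 12, 13, 14, 15, 16, 17]"
    by (simp add: upt_conv_Cons eval_nat_numeral)
  have "(\<Sum>j<18. f (j div 9) (of_nat j :: 3) (of_nat (j div 3) :: 3)) =
    sum_list (map (\<lambda>j. f (j div 9) (of_nat j :: 3) (of_nat (j div 3) :: 3)) [0..<18])"
    by (simp only: interv_sum_list_conv_sum_set_nat atLeast0LessThan set_upt)
  also have "\<dots> = (\<Sum>k<2. \<Sum>p\<in>UNIV. \<Sum>q\<in>UNIV. f k p q)"
    unfolding upt by (simp add: sum_three reduce numeral_2_eq_2 ac_simps)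
  finally show ?thesis .
qed

lemma sum_runs: "(\<Sum>k<2. \<Sum>i<4. f (4 * k + i)) = (\<Sum>n<8. f n)"
  for f :: "nat \<Rightarrow> 'a::comm_monoid_add"
  by (simp add: eval_nat_numeral ac_simps)

lemma length_filter_sum: "length (filter P xs) = (\<Sum>i<length xs. of_bool (P (xs ! i)))"
  by (induct xs rule: rev_induct) (auto simp: nth_append intro!: sum.cong)

section \<open>Orthogonality between classes\<close>

text \<open>\<open>F n\<close> and \<open>G n\<close> count the translations taking initial run
  \<open>n\<close> to level \<open>\<alpha>\<close> of \<open>a\<close> and \<open>\<beta>\<close>
  of \<open>b\<close>. By independence, nine times either side is a sum of products
  \<open>F m * G n\<close>: on the left four times the sum over \<open>m = n\<close>, on the right
  over all pairs within an initial block.\<close>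

lemma plan_orthogonal:
  assumes "class_vec b \<noteq> class_vec a" "class_vec b \<noteq> (2 * fst (class_vec a), 2 * snd (class_vec a))"
  shows "4 * N_entry plan a b \<alpha> \<beta> = (\<Sum>j<length plan. L_entry plan a \<alpha> j * L_entry plan b \<beta> j)"
proof -
  define f where "f n t = (of_bool (dot a (vec5 (initial_runs ! n)) + t = \<alpha>) :: nat)" for n t
  define g where "g n t = (of_bool (dot b (vec5 (initial_runs ! n)) + t = \<beta>) :: nat)" for n t
  define \<phi> where "\<phi> p q = p * fst (class_vec a) + q * snd (class_vec a)" for p q
  define \<psi> where "\<psi> p q = p * fst (class_vec b) + q * snd (class_vec b)" for p q
  define F where "F n = (\<Sum>p\<in>UNIV. \<Sum>q\<in>UNIV. f n (\<phi> p q))" for n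
  define G where "G n = (\<Sum>p\<in>UNIV. \<Sum>q\<in>UNIV. g n (\<psi> p q))" for n
  have mix: "9 * (\<Sum>p\<in>UNIV. \<Sum>q\<in>UNIV. f m (\<phi> p q) * g n (\<psi> p q)) = F m * G n" for m n
    unfolding F_def G_def \<phi>_def \<psi>_def
    by (rule sum_independent_three) (use assms in \<open>auto simp: prod_eq_iff\<close>)
  have ones: "(\<Sum>t\<in>UNIV. of_bool (y + t = s)) = (1 :: nat)" for y s :: 3
  proof -
    have "y + t = s \<longleftrightarrow> t = s - y" for t by auto
    then show ?thesis by simp
  qed
  have F3: "F n = 3" if "class_vec a \<noteq> (0, 0)" for n
    using sum_affine_three[of "fst (class_vec a)" "snd (class_vec a)" "f n" 0] that
    by (simp add: F_def \<phi>_def f_def ones)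
  have G3: "G n = 3" if "class_vec b \<noteq> (0, 0)" for n
    using sum_affine_three[of "fst (class_vec b)" "snd (class_vec b)" "g n" 0] that
    by (simp add: G_def \<psi>_def g_def ones)
  have L: "L_entry plan a \<alpha> j = (\<Sum>i<4. f (4 * (j div 9) + i) (\<phi> (of_nat j) (of_nat (j div 3))))"
    "L_entry plan b \<beta> j = (\<Sum>i<4. g (4 * (j div 9) + i) (\<psi> (of_nat j) (of_nat (j div 3))))" if "j < 18" for j
    using that by (auto simp: L_entry_def length_filter_sum dot_plan_nth f_def g_def \<phi>_def \<psi>_def)
  have "N_entry plan a b \<alpha> \<beta> = (\<Sum>j<18. length (filter (\<lambda>x. dot a x = \<alpha> \<and> dot b x = \<beta>) (plan ! j)))"
    by (simp add: N_entry_def filter_concat length_concat sum_list_sum_nth atLeast0LessThan)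
  also have "\<dots> = (\<Sum>j<18. \<Sum>i<4. f (4 * (j div 9) + i) (\<phi> (of_nat j) (of_nat (j div 3)))
      * g (4 * (j div 9) + i) (\<psi> (of_nat j) (of_nat (j div 3))))"
    by (intro sum.cong refl, subst length_filter_sum, rule sum.cong)
      (simp_all add: dot_plan_nth f_def g_def \<phi>_def \<psi>_def of_bool_conj)
  also have "\<dots> = (\<Sum>k<2. \<Sum>p\<in>UNIV. \<Sum>q\<in>UNIV. \<Sum>i<4. f (4 * k + i) (\<phi> p q) * g (4 * k + i) (\<psi> p q))"
    by (rule sum_blocks)
  also have "\<dots> = (\<Sum>k<2. \<Sum>i<4. \<Sum>p\<in>UNIV. \<Sum>q\<in>UNIV. f (4 * k + i) (\<phi> p q) * g (4 * k + i) (\<psi> p q))"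
    by (simp add: sum.swap[of _ "{..<4}"])
  finally have N: "9 * N_entry plan a b \<alpha> \<beta> = (\<Sum>k<2. \<Sum>i<4. F (4 * k + i) * G (4 * k + i))"
    by (simp only: mix[symmetric] sum_distrib_left)
  have "(\<Sum>j<length plan. L_entry plan a \<alpha> j * L_entry plan b \<beta> j)
    = (\<Sum>j<18. (\<Sum>i<4. f (4 * (j div 9) + i) (\<phi> (of_nat j) (of_nat (j div 3))))
       * (\<Sum>i<4. g (4 * (j div 9) + i) (\<psi> (of_nat j) (of_nat (j div 3)))))"
    by (simp add: L)
  also have "\<dots> = (\<Sum>k<2. \<Sum>p\<in>UNIV. \<Sum>q\<in>UNIV. (\<Sum>i<4. f (4 * k + i) (\<phi> p q)) * (\<Sum>i<4. g (4 * k + i) (\<psi> p q)))"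
    by (rule sum_blocks)
  also have "\<dots> = (\<Sum>k<2. \<Sum>i<4. \<Sum>i'<4. \<Sum>p\<in>UNIV. \<Sum>q\<in>UNIV. f (4 * k + i) (\<phi> p q) * g (4 * k + i') (\<psi> p q))"
    by (simp add: sum_product sum.swap[of _ "{..<4}" UNIV])
  finally have LL: "9 * (\<Sum>j<length plan. L_entry plan a \<alpha> j * L_entry plan b \<beta> j)
    = (\<Sum>k<2. \<Sum>i<4. \<Sum>i'<4. F (4 * k + i) * G (4 * k + i'))"
    by (simp only: mix[symmetric] sum_distrib_left)
  \<comment> \<open>Distinct functionals are not both zero. A non-zero one makes its counts
    constantly 3, so the sum over pairs is four times the sum over single runs.\<close>
  have "class_vec a \<noteq> (0, 0) \<or> class_vec b \<noteq> (0, 0)"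
    using assms(1) by auto
  then have "9 * (4 * N_entry plan a b \<alpha> \<beta>) = 9 * (\<Sum>j<length plan. L_entry plan a \<alpha> j * L_entry plan b \<beta> j)"
  proof
    assume "class_vec a \<noteq> (0, 0)"
    then show ?thesis
      unfolding LL using arg_cong[OF N, of "(*) 4"] by (simp add: F3 sum_distrib_left)
  next
    assume "class_vec b \<noteq> (0, 0)"
    then show ?thesis
      unfolding LL using arg_cong[OF N, of "(*) 4"] by (simp add: G3 sum_distrib_left)
  qed
  then show ?thesis by simp
qed

lemma class_vec_scale: "class_vec (2 *s a) = (2 * fst (class_vec a), 2 * snd (class_vec a))"
  by (simp add: class_vec_def dot_scale_left)

lemma class_vec_effect: "class_vec ` effect a = {class_vec a, (2 * fst (class_vec a), 2 * snd (class_vec a))}"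
  by (simp add: effect_def class_vec_scale)

text \<open>The image of an effect under \<open>class_vec\<close> is its functional up to sign, so
  it labels the class whatever representatives are taken.\<close>

lemma orthogonal_if_class_vecs_differ:
  assumes "class_vec ` effect a' \<noteq> class_vec ` effect b'"
  shows "orthogonal_through_blocks 4 plan (effect a') (effect b')"
  unfolding orthogonal_through_blocks_def
proof (intro ballI allI plan_orthogonal)
  fix a b assume "a \<in> effect a'" "b \<in> effect b'"
  then have *: "class_vec ` effect a \<noteq> class_vec ` effect b"
    using assms by (simp add: effect_eq)
  then show "class_vec b \<noteq> class_vec a" "class_vec b \<noteq> (2 * fst (class_vec a), 2 * snd (class_vec a))"
    by (cases "class_vec a"; cases "class_vec b"; auto simp: class_vec_effect)+
qed

section \<open>The table of coefficients\<close>

text \<open>The pair \<open>(x, y)\<close> stands for the Eisenstein integer \<open>x + y\<omega>\<close>, and \<open>weight (x, y)\<close> is three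
  times the function \<open>F \<rightarrow> \<rat>\<close> with sum zero corresponding to it, so that shifts of the argument
  correspond to multiplication by \<open>\<omega>\<close>.\<close>

fun weight :: "int \<times> int \<Rightarrow> 'a::zero_neq_one \<Rightarrow> int" where
  "weight (x, y) u = (if u = 0 then 2 * x - y else if u = 1 then 2 * y - x else - x - y)"

text \<open>One representative of each of the 24 effects to be estimated, with coefficients for the
  eight initial runs. Inside a class the representatives restrict to the same functional on the
  translation group. In each class with non-zero functional, the coefficient vectors are three
  times the rows of the inverse of the matrix with rows \<open>\<omega>\<close> to the power \<open>dot b x\<close> (\<open>x\<close> an initial run)
  for the representatives \<open>b\<close> and the two block indicators; for the class of five effects any
  left inverse may be used. The last row belongs to \<open>AB\<^sup>2\<close>, which takes all
  its levels in the first initial block.\<close>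

definition rows :: "(int list \<times> (int \<times> int) list) list" where
  "rows = [
  ([2,2,0,0,0], [(0,0), (1,0), (0,0), (-1,0), (0,0), (-1,-1), (0,0), (1,1)]),
  ([1,0,0,0,0], [(1,0), (0,0), (0,1), (-1,-1), (0,0), (0,0), (-1,-1), (1,1)]),
  ([0,1,0,0,0], [(0,0), (1,0), (0,0), (-1,0), (0,0), (0,1), (0,0), (0,-1)]),
  ([0,0,2,2,0], [(-1,0), (1,0), (-1,-1), (1,1), (1,0), (-1,-1), (0,1), (0,0)]),
  ([0,0,1,0,2], [(1,0), (-1,0), (0,0), (0,0), (0,1), (0,-1), (0,0), (0,0)]),
  ([0,0,0,1,1], [(1,0), (-1,0), (0,0), (0,0), (-1,-1), (1,1), (0,0), (0,0)]),
  ([2,0,2,0,0], [(1,0), (0,0), (-1,-1), (0,1), (0,0), (0,0), (0,1), (0,-1)]),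
  ([1,0,0,0,2], [(1,0), (0,0), (0,0), (-1,0), (-1,-1), (0,0), (0,0), (1,1)]),
  ([0,2,2,0,0], [(0,0), (-1,-1), (0,0), (1,1), (0,0), (0,1), (0,0), (0,-1)]),
  ([0,1,0,0,2], [(0,0), (0,1), (0,0), (0,-1), (0,0), (-1,-1), (0,0), (1,1)]),
  ([0,0,1,0,1], [(1,0), (1,0), (-1,0), (-1,0), (0,-1), (1,0), (-1,0), (0,1)]),
  ([0,0,0,1,0], [(0,0), (0,0), (1,1), (-1,-1), (0,1), (0,0), (0,-1), (0,0)]),
  ([2,0,1,0,0], [(1,0), (0,0), (-1,-1), (0,1), (0,0), (0,0), (0,1), (0,-1)]),
  ([1,0,0,2,0], [(0,0), (0,1), (1,0), (-1,-1), (-1,0), (-1,-1), (1,0), (1,1)]),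
  ([0,2,1,0,0], [(0,0), (0,1), (0,0), (0,-1), (0,0), (1,0), (0,0), (-1,0)]),
  ([0,1,0,2,0], [(0,0), (0,1), (0,0), (0,-1), (0,0), (-1,-1), (0,0), (1,1)]),
  ([0,0,2,1,0], [(0,0), (0,-1), (0,1), (0,0), (0,-1), (1,1), (-1,-1), (0,1)]),
  ([0,0,0,0,1], [(1,0), (0,-1), (0,0), (-1,1), (0,1), (-1,0), (0,0), (1,-1)]),
  ([2,0,0,2,0], [(1,0), (0,0), (0,1), (-1,-1), (0,0), (0,0), (-1,-1), (1,1)]),
  ([1,0,0,0,1], [(1,0), (0,0), (-1,-1), (0,1), (0,0), (0,0), (0,1), (0,-1)]),
  ([0,2,0,2,0], [(0,0), (0,1), (0,0), (0,-1), (0,0), (1,0), (0,0), (-1,0)]),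
  ([0,1,0,0,1], [(0,0), (-1,-1), (0,0), (1,1), (0,0), (1,0), (0,0), (-1,0)]),
  ([0,0,1,0,0], [(0,0), (0,0), (1,-1), (-1,1), (0,0), (-1,1), (0,0), (1,-1)]),
  ([1,2,0,0,0], [(1,0), (0,0), (-1,-1), (0,1), (0,0), (0,0), (0,0), (0,0)])]"

section \<open>Finite checks of the table, by evaluation over the integers\<close>

definition int_class_vec :: "int list \<Rightarrow> int \<times> int" where
  "int_class_vec a = (ldot a dir1 mod 3, ldot a dir2 mod 3)"

text \<open>For \<open>b\<close> in the class of the row, \<open>u - ldot b x\<close> is the
  functional value of those translations that take \<open>x\<close> to level \<open>u\<close> of
  \<open>b\<close>; so this is, up to scale, the total coefficient falling on that level.\<close>

definition fiber_sum :: "(int \<times> int) list \<Rightarrow> int list \<Rightarrow> int \<Rightarrow> int" where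
  "fiber_sum ws b u = sum_list (map2 (\<lambda>w x. weight w ((u - ldot b x) mod 3)) ws initial_runs)"

lemma rows_length: "list_all (\<lambda>(a, ws). length a = 5 \<and> length ws = 8) rows"
  by code_simp

text \<open>The representatives are signed coherently: functionals of two rows that differ are not
  negatives of each other either, as \<open>sum_independent_three\<close> requires.\<close>

lemma rows_class_vecs: "list_all (\<lambda>(a, _). list_all (\<lambda>(b, _). int_class_vec b = int_class_vec a \<or>
    int_class_vec b \<noteq> int_class_vec a \<and> int_class_vec b \<noteq> (2 * fst (int_class_vec a) mod 3, 2 * snd (int_class_vec a) mod 3)) rows) rows"
  by code_simp

text \<open>This is what eliminates the block effects: the coefficients sum to zero over each
  initial block.\<close>

lemma rows_block_sums: "list_all (\<lambda>(_, ws). list_all (\<lambda>u. sum_list (map (\<lambda>w. weight w u) (take 4 ws)) = 0 \<and>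
    sum_list (map (\<lambda>w. weight w u) (drop 4 ws)) = 0) [0, 1, 2 :: int]) rows"
  by code_simp

text \<open>The inverse matrix identity seen through \<open>weight\<close>: the values 6, -3, -3 are
  those of \<open>weight (3, 0)\<close>, the 3 being the factor in the tabulated
  coefficients.\<close>

lemma rows_fiber_sums: "list_all (\<lambda>(a, ws). list_all (\<lambda>(b, _).
    int_class_vec b = int_class_vec a \<longrightarrow> int_class_vec a \<noteq> (0, 0) \<longrightarrow>
    list_all (\<lambda>u. fiber_sum ws b u = (if a = b then if u = 0 then 6 else -3 else 0)) [0, 1, 2]) rows) rows"
  by code_simp

text \<open>With zero functional, translations do not change the level, so the initial runs alone
  must separate the levels; this class is a single row.\<close>

lemma rows_class_vec_0: "list_all (\<lambda>(a, ws). list_all (\<lambda>(b, _).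
    int_class_vec b = int_class_vec a \<longrightarrow> int_class_vec a = (0, 0) \<longrightarrow> a = b \<and>
    list_all (\<lambda>s. list_all (\<lambda>t. sum_list (map2 (\<lambda>w x. if ldot b x mod 3 = t then weight w (- s mod 3) else 0) ws initial_runs)
      = (if s = t then 2 else -1)) [0, 1, 2]) [0, 1, 2]) rows) rows"
  by code_simp

lemma rows_exhaust: "list_all (\<lambda>a. length (filter ((\<noteq>) 0) a) \<in> {1, 2} \<longrightarrow>
    a \<in> {[0,0,0,1,2], [0,0,0,2,1]} \<or> a \<in> set (map fst rows) \<or> map (\<lambda>x. 2 * x mod 3) a \<in> set (map fst rows))
    (List.n_lists 5 [0, 1, 2])"
  by code_simp

section \<open>Transfer of the checks from the integers to the field\<close>

lemma three_int_cases:
  obtains z where "z \<in> {0, 1, 2}" "u = (of_int z :: 3)"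
  using three_cases[of u] that[of 0] that[of 1] that[of 2] by auto

lemma mod_three_cases: "z mod 3 \<in> {0, 1, 2}" for z :: int
  by auto

lemma weight_of_int: "weight w (of_int z :: 3) = weight w (z mod 3)"
proof -
  have "weight w (of_int r :: 3) = weight w r" if "r \<in> {0, 1, 2}" for r
    using that by (cases w) auto
  from this[OF mod_three_cases] show ?thesis
    by (simp only: of_int_mod_three)
qed

lemma sum_weight: "(\<Sum>u\<in>UNIV. weight w (u :: 3)) = 0"
  by (cases w) (simp add: sum_three)

lemma dot_initial_runs:
  assumes "length a = 5" "n < 8"
  shows "dot (vec5 a) (vec5 (initial_runs ! n)) = of_int (ldot a (initial_runs ! n))"
proof -
  have "list_all (\<lambda>x. length x = 5) initial_runs" by code_simp
  then show ?thesis using assms by (simp add: dot_vec5 list_all_length)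
qed

lemma class_vec_vec5:
  assumes "length a = 5"
  shows "class_vec (vec5 a) = (of_int (fst (int_class_vec a)), of_int (snd (int_class_vec a)))"
  using assms by (simp add: class_vec_def int_class_vec_def of_int_mod_three dot_vec5 dir1_def dir2_def)

lemma weight_block_sums:
  assumes "(a, ws) \<in> set rows"
  shows "(\<Sum>i<4. weight (ws ! i) (u :: 3)) = 0" "(\<Sum>i<4. weight (ws ! (4 + i)) u) = 0"
proof -
  obtain z where z: "z \<in> {0, 1, 2}" "u = of_int z"
    by (rule three_int_cases)
  have len: "length ws = 8"
    using rows_length assms by (auto simp: list_all_iff)
  have "sum_list (map (\<lambda>w. weight w z) (take 4 ws)) = 0" "sum_list (map (\<lambda>w. weight w z) (drop 4 ws)) = 0"
    using rows_block_sums assms z(1) by (fastforce simp: list_all_iff)+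
  moreover have "z mod 3 = z" using z(1) by auto
  ultimately show "(\<Sum>i<4. weight (ws ! i) u) = 0" "(\<Sum>i<4. weight (ws ! (4 + i)) u) = 0"
    using len by (simp_all add: sum_list_sum_nth atLeast0LessThan z(2) weight_of_int)
qed

section \<open>The estimators and their expectations\<close>

text \<open>Estimates the deviation at level \<open>s\<close>; subtracting \<open>s\<close> rotates
  the weights from level 0 to level \<open>s\<close>. The divisor 27 is 3 translations per
  functional value times the gap 6 - (-3), and for the zero functional 9 translations times the gap
  2 - (-1).\<close>

definition estimator :: "int list \<Rightarrow> (int \<times> int) list \<Rightarrow> 3 \<Rightarrow> nat \<Rightarrow> nat \<Rightarrow> real" where
  "estimator a ws s j i = real_of_int (weight (ws ! (4 * (j div 9) + i))
     (of_nat j * fst (class_vec (vec5 a)) + of_nat (j div 3) * snd (class_vec (vec5 a)) - s)) / 27"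

lemma estimator_block_sum:
  assumes "(a, ws) \<in> set rows" "j < 18"
  shows "(\<Sum>i<4. estimator a ws s j i) = 0"
proof -
  have "j div 9 = 0 \<or> j div 9 = 1"
    using assms(2) by linarith
  then show ?thesis
    using weight_block_sums[OF assms(1)]
    by (auto simp: estimator_def simp flip: sum_divide_distrib of_int_sum)
qed

lemma weight_fiber_sums:
  assumes "(a, ws) \<in> set rows" "(b, ws') \<in> set rows"
    and "class_vec (vec5 b) = class_vec (vec5 a)" "class_vec (vec5 a) \<noteq> (0, 0)"
  shows "(\<Sum>n<8. weight (ws ! n) (u - dot (vec5 b) (vec5 (initial_runs ! n)))) = (if a = b then if u = 0 then 6 else -3 else 0)"
proof -
  obtain z where z: "z \<in> {0, 1, 2}" "u = of_int z"
    by (rule three_int_cases)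
  have len: "length ws = 8" "length a = 5" "length b = 5"
    using rows_length assms(1,2) by (auto simp: list_all_iff)
  have "int_class_vec b = int_class_vec a" "int_class_vec a \<noteq> (0, 0)"
    using assms(3,4) len by (auto simp: class_vec_vec5 of_int_eq_iff_three int_class_vec_def)
  then have "fiber_sum ws b z = (if a = b then if z = 0 then 6 else -3 else 0)"
    using rows_fiber_sums assms(1,2) z(1) unfolding list_all_iff by fastforce
  moreover have "fiber_sum ws b z = (\<Sum>n<8. weight (ws ! n) (u - dot (vec5 b) (vec5 (initial_runs ! n))))"
    using len by (simp add: fiber_sum_def sum_list_sum_nth atLeast0LessThan dot_initial_runs z(2) weight_of_int
        flip: of_int_diff)
  moreover have "u = 0 \<longleftrightarrow> z = 0"
    using z by auto
  ultimately show ?thesis by simp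
qed

lemma weight_class_vec_0:
  assumes "(a, ws) \<in> set rows" "(b, ws') \<in> set rows"
    and "class_vec (vec5 b) = class_vec (vec5 a)" "class_vec (vec5 a) = (0, 0)"
  shows "a = b"
    and "(\<Sum>n<8. if dot (vec5 b) (vec5 (initial_runs ! n)) = t then weight (ws ! n) (- s) else 0) = (if s = t then 2 else -1)"
proof -
  obtain z where z: "z \<in> {0, 1, 2}" "s = of_int z"
    by (rule three_int_cases)
  obtain y where y: "y \<in> {0, 1, 2}" "t = of_int y"
    by (rule three_int_cases)
  have len: "length ws = 8" "length a = 5" "length b = 5"
    using rows_length assms(1,2) by (auto simp: list_all_iff)
  have "int_class_vec b = int_class_vec a" "int_class_vec a = (0, 0)"
    using assms(3,4) len of_int_eq_iff_three[of _ 0] by (auto simp: class_vec_vec5 of_int_eq_iff_three int_class_vec_def)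
  then have "a = b \<and> sum_list (map2 (\<lambda>w x. if ldot b x mod 3 = y then weight w (- z mod 3) else 0) ws initial_runs)
      = (if z = y then 2 else -1)"
    using rows_class_vec_0 assms(1,2) z(1) y(1) unfolding list_all_iff by fastforce
  moreover have "sum_list (map2 (\<lambda>w x. if ldot b x mod 3 = y then weight w (- z mod 3) else 0) ws initial_runs)
      = (\<Sum>n<8. if dot (vec5 b) (vec5 (initial_runs ! n)) = t then weight (ws ! n) (- s) else 0)"
  proof -
    have "y mod 3 = y" using y(1) by auto
    moreover have neg: "weight w (- s) = weight w (- z mod 3)" for w
      using weight_of_int[of w "- z"] z(2) by simp
    ultimately show ?thesis
      using len by (simp add: neg sum_list_sum_nth atLeast0LessThan dot_initial_runs y(2) of_int_eq_iff_three cong: if_cong)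
  qed
  moreover have "s = t \<longleftrightarrow> z = y"
    using z y by auto
  ultimately show "a = b"
    "(\<Sum>n<8. if dot (vec5 b) (vec5 (initial_runs ! n)) = t then weight (ws ! n) (- s) else 0) = (if s = t then 2 else -1)"
    by simp_all
qed

lemma rows_class_vec_cases:
  assumes "(a, ws) \<in> set rows" "(b, ws') \<in> set rows"
    and "class_vec (vec5 b) \<noteq> class_vec (vec5 a)"
  shows "class_vec (vec5 b) \<noteq> (2 * fst (class_vec (vec5 a)), 2 * snd (class_vec (vec5 a)))"
proof -
  have len: "length a = 5" "length b = 5"
    using rows_length assms(1,2) by (auto simp: list_all_iff)
  have "int_class_vec b \<noteq> int_class_vec a"
    using assms(3) len by (auto simp: class_vec_vec5)
  then have "int_class_vec b \<noteq> (2 * fst (int_class_vec a) mod 3, 2 * snd (int_class_vec a) mod 3)"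
    using rows_class_vecs assms(1,2) unfolding list_all_iff by fastforce
  moreover have "fst (int_class_vec b) mod 3 = fst (int_class_vec b)" "snd (int_class_vec b) mod 3 = snd (int_class_vec b)"
    by (simp_all add: int_class_vec_def)
  moreover have "(2 :: 3) * of_int x = of_int (2 * x)" for x
    by simp
  ultimately show ?thesis
    using len by (auto simp: class_vec_vec5 of_int_eq_iff_three prod_eq_iff simp del: of_int_mult)
qed

text \<open>Different classes decouple by \<open>sum_independent_three\<close>; inside a class, the
  translated runs are regrouped by their level of \<open>b\<close> and the table decides.\<close>

lemma estimator_effect:
  assumes "(a, ws) \<in> set rows" "(b, ws') \<in> set rows"
  shows "(\<Sum>j<18. \<Sum>i<4. estimator a ws s j i * F (dot (vec5 b) (plan ! j ! i)))
    = (if a = b then F s - (\<Sum>t\<in>UNIV. F t) / 3 else 0)"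
proof -
  define y where "y n = dot (vec5 b) (vec5 (initial_runs ! n))" for n
  define K where "K n u = real_of_int (weight (ws ! n) (u - s))" for n and u :: 3
  define \<phi> where "\<phi> p q = p * fst (class_vec (vec5 a)) + q * snd (class_vec (vec5 a))" for p q
  define \<psi> where "\<psi> p q = p * fst (class_vec (vec5 b)) + q * snd (class_vec (vec5 b))" for p q
  have K0: "(\<Sum>u\<in>UNIV. K n u) = 0" for n
  proof -
    have "(\<Sum>u\<in>UNIV. weight (ws ! n) (u - s)) = (\<Sum>u\<in>UNIV. weight (ws ! n) (u :: 3))"
      by (rule sum.reindex_bij_witness[where i = "\<lambda>u. u + s" and j = "\<lambda>u. u - s"]) auto
    then show ?thesis
      by (simp add: K_def sum_weight flip: of_int_sum)
  qed
  have "(\<Sum>j<18. \<Sum>i<4. estimator a ws s j i * F (dot (vec5 b) (plan ! j ! i)))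
    = (\<Sum>j<18. \<Sum>i<4. K (4 * (j div 9) + i) (\<phi> (of_nat j) (of_nat (j div 3)))
        * F (y (4 * (j div 9) + i) + \<psi> (of_nat j) (of_nat (j div 3)))) / 27"
    by (simp add: estimator_def dot_plan_nth K_def y_def \<phi>_def \<psi>_def sum_divide_distrib)
  also have "(\<Sum>j<18. \<Sum>i<4. K (4 * (j div 9) + i) (\<phi> (of_nat j) (of_nat (j div 3)))
        * F (y (4 * (j div 9) + i) + \<psi> (of_nat j) (of_nat (j div 3))))
      = (\<Sum>k<2. \<Sum>p\<in>UNIV. \<Sum>q\<in>UNIV. \<Sum>i<4. K (4 * k + i) (\<phi> p q) * F (y (4 * k + i) + \<psi> p q))"
    by (rule sum_blocks)
  also have "\<dots> = (\<Sum>k<2. \<Sum>i<4. \<Sum>p\<in>UNIV. \<Sum>q\<in>UNIV. K (4 * k + i) (\<phi> p q) * F (y (4 * k + i) + \<psi> p q))"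
    by (simp add: sum.swap[of _ "{..<4}"])
  also have "\<dots> = (\<Sum>n<8. \<Sum>p\<in>UNIV. \<Sum>q\<in>UNIV. K n (\<phi> p q) * F (y n + \<psi> p q))"
    by (rule sum_runs)
  finally have eq: "(\<Sum>j<18. \<Sum>i<4. estimator a ws s j i * F (dot (vec5 b) (plan ! j ! i)))
    = (\<Sum>n<8. \<Sum>p\<in>UNIV. \<Sum>q\<in>UNIV. K n (\<phi> p q) * F (y n + \<psi> p q)) / 27" .
  consider "class_vec (vec5 b) \<noteq> class_vec (vec5 a)"
    | "class_vec (vec5 b) = class_vec (vec5 a)" "class_vec (vec5 a) \<noteq> (0, 0)"
    | "class_vec (vec5 b) = class_vec (vec5 a)" "class_vec (vec5 a) = (0, 0)"
    by blast
  then have "(\<Sum>n<8. \<Sum>p\<in>UNIV. \<Sum>q\<in>UNIV. K n (\<phi> p q) * F (y n + \<psi> p q))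
    = (if a = b then 27 * F s - 9 * (\<Sum>t\<in>UNIV. F t) else 0)"
  proof cases
    case 1
    have "9 * (\<Sum>p\<in>UNIV. \<Sum>q\<in>UNIV. K n (\<phi> p q) * F (y n + \<psi> p q))
      = (\<Sum>p\<in>UNIV. \<Sum>q\<in>UNIV. K n (\<phi> p q)) * (\<Sum>p\<in>UNIV. \<Sum>q\<in>UNIV. F (y n + \<psi> p q))" for n
      unfolding \<phi>_def \<psi>_def
      by (rule sum_independent_three) (use 1 rows_class_vec_cases[OF assms 1] in \<open>auto simp: prod_eq_iff\<close>)
    then have mix: "9 * (\<Sum>n<8. \<Sum>p\<in>UNIV. \<Sum>q\<in>UNIV. K n (\<phi> p q) * F (y n + \<psi> p q))
      = (\<Sum>n<8. (\<Sum>p\<in>UNIV. \<Sum>q\<in>UNIV. K n (\<phi> p q)) * (\<Sum>p\<in>UNIV. \<Sum>q\<in>UNIV. F (y n + \<psi> p q)))"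
      by (simp add: sum_distrib_left[of 9 _ "{..<8}"])
    also have "\<dots> = 0"
    proof (cases "class_vec (vec5 a) = (0, 0)")
      \<comment> \<open>Over the translations the weights of each run run evenly through
        \<open>F\<close>, where they sum to zero.\<close>
      case False
      then have "(\<Sum>p\<in>UNIV. \<Sum>q\<in>UNIV. K n (\<phi> p q)) = 0" for n
        using sum_affine_three[of "fst (class_vec (vec5 a))" "snd (class_vec (vec5 a))" "K n" 0]
        by (simp add: \<phi>_def K0 prod_eq_iff)
      then show ?thesis by simp
    next
      \<comment> \<open>Here the weights are constant along translations and the sums of
        \<open>F\<close> do not depend on the run, so the zero block sums apply.\<close>
      case True
      then have "(\<Sum>p\<in>UNIV. \<Sum>q\<in>UNIV. F (y n + \<psi> p q)) = 3 * (\<Sum>t\<in>UNIV. F t)" for n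
        using sum_affine_three[of "fst (class_vec (vec5 b))" "snd (class_vec (vec5 b))" F] 1
        by (simp add: \<psi>_def prod_eq_iff)
      moreover have "(\<Sum>p\<in>UNIV. \<Sum>q\<in>UNIV. K n (\<phi> p q)) = 9 * K n 0" for n
        using True by (simp add: \<phi>_def)
      moreover have "(\<Sum>n<8. K n 0) = 0"
        using weight_block_sums[OF assms(1), of "- s"]
        by (simp add: K_def numeral_2_eq_2 flip: of_int_sum sum_runs)
      ultimately show ?thesis
        by (simp flip: sum_distrib_right sum_distrib_left)
    qed
    finally show ?thesis
      using 1 by auto
  next
    case 2
    \<comment> \<open>Both functionals agree, so substituting the level \<open>t = y n + u\<close>
      reached by the translated run collects the weight on each level of \<open>b\<close>.\<close>
    have "(\<Sum>p\<in>UNIV. \<Sum>q\<in>UNIV. K n (\<phi> p q) * F (y n + \<psi> p q)) = 3 * (\<Sum>t\<in>UNIV. K n (t - y n) * F t)" for n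
    proof -
      have "(\<Sum>p\<in>UNIV. \<Sum>q\<in>UNIV. K n (\<phi> p q) * F (y n + \<psi> p q)) = 3 * (\<Sum>u\<in>UNIV. K n u * F (y n + u))"
        using sum_affine_three[of "fst (class_vec (vec5 a))" "snd (class_vec (vec5 a))" "\<lambda>u. K n u * F (y n + u)" 0] 2
        by (simp add: \<phi>_def \<psi>_def prod_eq_iff)
      also have "(\<Sum>u\<in>UNIV. K n u * F (y n + u)) = (\<Sum>t\<in>UNIV. K n (t - y n) * F t)"
        by (rule sum.reindex_bij_witness[where i = "\<lambda>t. t - y n" and j = "\<lambda>u. y n + u"]) auto
      finally show ?thesis .
    qed
    then have "(\<Sum>n<8. \<Sum>p\<in>UNIV. \<Sum>q\<in>UNIV. K n (\<phi> p q) * F (y n + \<psi> p q))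
      = 3 * (\<Sum>t\<in>UNIV. (\<Sum>n<8. K n (t - y n)) * F t)"
      by (simp add: sum_distrib_right sum.swap[of _ "{..<8}"] flip: sum_distrib_left)
    also have "\<dots> = 3 * (\<Sum>t\<in>UNIV. (if a = b then if t = s then 6 else -3 else 0) * F t)"
    proof -
      have "(\<Sum>n<8. K n (t - y n)) = (if a = b then if t = s then 6 else -3 else 0)" for t
        using weight_fiber_sums[OF assms 2, of "t - s"]
        by (simp add: K_def y_def algebra_simps flip: of_int_sum)
      then show ?thesis by simp
    qed
    also have "3 * (\<Sum>t\<in>UNIV. (if a = b then if t = s then 6 else -3 else 0) * F t)
      = (if a = b then 27 * F s - 9 * (\<Sum>t\<in>UNIV. F t) else 0)"
      using three_cases[of s] by (auto simp: sum_three)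
    finally show ?thesis .
  next
    case 3
    \<comment> \<open>Neither factor changes under the nine translations.\<close>
    have "(\<Sum>p\<in>UNIV. \<Sum>q\<in>UNIV. K n (\<phi> p q) * F (y n + \<psi> p q))
      = 9 * (\<Sum>t\<in>UNIV. (if y n = t then K n 0 else 0) * F t)" for n
      using 3 by (simp add: \<phi>_def \<psi>_def if_distrib[of "\<lambda>x. x * _"] cong: if_cong)
    then have "(\<Sum>n<8. \<Sum>p\<in>UNIV. \<Sum>q\<in>UNIV. K n (\<phi> p q) * F (y n + \<psi> p q))
      = 9 * (\<Sum>t\<in>UNIV. (\<Sum>n<8. if y n = t then K n 0 else 0) * F t)"
      by (simp only: sum_distrib_right sum.swap[of _ "{..<8}" UNIV] flip: sum_distrib_left)
    also have "\<dots> = 9 * (\<Sum>t\<in>UNIV. (if s = t then 2 else -1) * F t)"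
    proof -
      have "(\<Sum>n<8. if y n = t then K n 0 else 0) = (if s = t then 2 else -1)" for t
      proof -
        have "(\<Sum>n<8. if y n = t then K n 0 else 0)
          = of_int (\<Sum>n<8. if y n = t then weight (ws ! n) (- s) else 0)"
          by (simp add: K_def if_distrib cong: if_cong)
        then show ?thesis
          using weight_class_vec_0(2)[OF assms 3, of t s] by (simp add: y_def)
      qed
      then show ?thesis by simp
    qed
    also have "9 * (\<Sum>t\<in>UNIV. (if s = t then 2 else -1) * F t) = 27 * F s - 9 * (\<Sum>t\<in>UNIV. F t)"
      using three_cases[of s] by (auto simp: sum_three)
    finally show ?thesis
      using weight_class_vec_0(1)[OF assms 3] by simp
  qed
  then show ?thesis
    unfolding eq by auto
qed

text \<open>Any representative is 1 or 2 times the tabulated vector, so it only relabels levels by a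
  factor that is its own inverse.\<close>

lemma estimates_plan:
  assumes "\<And>e. e \<in> S \<Longrightarrow> \<exists>a ws. (a, ws) \<in> set rows \<and> e = effect (vec5 a)"
  shows "estimates plan S"
proof (rule estimatesI)
  fix r e s
  assume r: "\<forall>f\<in>S. r f \<in> f" and e: "e \<in> S"
  obtain a ws where rows: "\<And>f. f \<in> S \<Longrightarrow> (a f, ws f) \<in> set rows"
    and a: "\<And>f. f \<in> S \<Longrightarrow> f = effect (vec5 (a f))"
    using assms by metis
  have "\<exists>\<epsilon>\<in>{1, 2}. r f = \<epsilon> *s vec5 (a f)" if "f \<in> S" for f
    using r a[OF that] that by (fastforce simp: effect_def)
  then obtain \<epsilon> where \<epsilon>: "\<And>f. f \<in> S \<Longrightarrow> \<epsilon> f \<in> {1, 2}" and r_eq: "\<And>f. f \<in> S \<Longrightarrow> r f = \<epsilon> f *s vec5 (a f)"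
    by metis
  have inv: "\<epsilon> f * (\<epsilon> f * t) = t" if "f \<in> S" for f t
    using \<epsilon>[OF that] by auto
  \<comment> \<open>Level \<open>s\<close> with respect to \<open>r e\<close> is level
    \<open>\<epsilon> e * s\<close> with respect to \<open>vec5 (a e)\<close>.\<close>
  define c where "c = estimator (a e) (ws e) (\<epsilon> e * s)"
  have "(\<Sum>j<18. \<Sum>i<4. c j i * F (dot (r f) (plan ! j ! i))) = (if f = e then F s - (\<Sum>t\<in>UNIV. F t) / 3 else 0)"
    if f: "f \<in> S" for f F
  proof -
    have "(\<Sum>j<18. \<Sum>i<4. c j i * F (dot (r f) (plan ! j ! i)))
      = (if a e = a f then F (\<epsilon> f * (\<epsilon> e * s)) - (\<Sum>t\<in>UNIV. F (\<epsilon> f * t)) / 3 else 0)"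
      unfolding c_def r_eq[OF f] dot_scale_left
      by (rule estimator_effect[OF rows[OF e] rows[OF f], where F = "\<lambda>t. F (\<epsilon> f * t)"])
    moreover have "(\<Sum>t\<in>UNIV. F (\<epsilon> f * t)) = (\<Sum>t\<in>UNIV. F t)"
      by (rule sum.reindex_bij_witness[where i = "\<lambda>t. \<epsilon> f * t" and j = "\<lambda>t. \<epsilon> f * t"]) (use inv[OF f] in auto)
    moreover have "a e = a f \<longleftrightarrow> f = e"
      using a e f by metis
    ultimately show ?thesis
      using inv[OF e] by auto
  qed
  moreover have "\<forall>j<18. (\<Sum>i<4. c j i) = 0"
    using estimator_block_sum[OF rows[OF e]] by (simp add: c_def)
  ultimately show "\<exists>c :: nat \<Rightarrow> nat \<Rightarrow> real. (\<forall>j<length plan. (\<Sum>i<length (plan ! j). c j i) = 0) \<and>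
      (\<forall>f\<in>S. \<forall>F. (\<Sum>j<length plan. \<Sum>i<length (plan ! j). c j i * F (dot (r f) (plan ! j ! i)))
         = (if f = e then F s - (\<Sum>t\<in>UNIV. F t) / 3 else 0))"
    by (intro exI[of _ c]) simp
qed

section \<open>Completeness of the table, confounding and the classes\<close>

lemma effects_exhaust:
  assumes "e \<in> main_effects \<union> two_factor_interactions" "e \<noteq> DE2"
  shows "\<exists>a ws. (a, ws) \<in> set rows \<and> e = effect (vec5 a)"
proof -
  obtain b where b: "e = effect b" "card {i. b $ i \<noteq> 0} \<in> {1, 2}"
    using assms(1) by (auto simp: main_effects_def two_factor_interactions_def)
  obtain a where a: "a \<in> set (List.n_lists 5 [0, 1, 2])" "b = vec5 a"
    by (rule vec5_exhaust)
  have len: "length a = 5"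
    using a(1) by (simp add: set_n_lists)
  have flip: "effect (vec5 (map (\<lambda>x. 2 * x mod 3) a)) = e"
    unfolding b a(2) by (rule effect_eq) (simp add: effect_def scale_vec5[OF len])
  have "a \<in> {[0,0,0,1,2], [0,0,0,2,1]} \<or> a \<in> set (map fst rows) \<or> map (\<lambda>x. 2 * x mod 3) a \<in> set (map fst rows)"
    using rows_exhaust a(1) b(2) card_support_vec5[OF a(1)] unfolding list_all_iff a(2) by auto
  moreover have "a \<noteq> [0,0,0,1,2]"
    using assms(2) a(2) b(1) by (auto simp: DE2_eq)
  moreover have "a \<noteq> [0,0,0,2,1]"
    using assms(2) flip by (auto simp: DE2_eq)
  ultimately consider "a \<in> set (map fst rows)" | "map (\<lambda>x. 2 * x mod 3) a \<in> set (map fst rows)"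
    by auto
  then show ?thesis
  proof cases
    case 1
    then show ?thesis using a(2) b(1) by auto
  next
    case 2
    then show ?thesis using flip by auto
  qed
qed

text \<open>A translation shifts the level equally for all four runs of a block, and the initial
  runs are all at level 0.\<close>

lemma confounded_DE2: "confounded plan DE2"
proof -
  have "dot (vec5 [0,0,0,1,2]) (vec5 (initial_runs ! n)) = 0" if "n < 8" for n
  proof -
    have "list_all (\<lambda>x. ldot [0,0,0,1,2] x mod 3 = 0) initial_runs" by code_simp
    then show ?thesis
      using that of_int_eq_iff_three[of _ 0] by (simp add: dot_initial_runs list_all_length)
  qed
  moreover have "4 * (j div 9) + i < 8" if "j < 18" "i < 4" for j i :: nat
  proof -
    have "j div 9 \<le> 1" using that by linarith
    then show ?thesis using that by linarith
  qed
  ultimately have "\<exists>t. \<forall>x\<in>set (plan ! j). dot a x = t" if "a \<in> DE2" "j < 18" for a j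
    using that by (intro exI[of _ "of_nat j * fst (class_vec a) + of_nat (j div 3) * snd (class_vec a)"])
      (auto simp: in_set_conv_nth dot_plan_nth DE2_eq effect_def dot_scale_left class_vec_scale algebra_simps)
  then show ?thesis
    by (auto simp: confounded_def in_set_conv_nth[of _ plan])
qed

lemma not_confoundedI:
  assumes "length a = 5" "i < 4" "i' < 4" "(ldot a (initial_runs ! i) - ldot a (initial_runs ! i')) mod 3 \<noteq> 0"
  shows "\<not> confounded plan (effect (vec5 a))"
proof
  assume "confounded plan (effect (vec5 a))"
  \<comment> \<open>Block 0 is the first initial block with zero translation.\<close>
  then obtain t where "\<forall>x\<in>set (plan ! 0). dot (vec5 a) x = t"
    unfolding confounded_def by (force simp: effect_def)
  then have "dot (vec5 a) (plan ! 0 ! i) = dot (vec5 a) (plan ! 0 ! i')"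
    using assms by simp
  then have "(of_int (ldot a (initial_runs ! i)) :: 3) = of_int (ldot a (initial_runs ! i'))"
    using assms by (simp add: dot_plan_nth dot_initial_runs)
  then show False
    using assms(4) by (simp add: of_int_eq_iff_three mod_eq_dvd_iff)
qed

text \<open>The classes are the fibres of \<open>\<kappa>\<close>, the functional up to sign, on the
  effects of interest.\<close>

lemma inter_class_orthogonal_plan: "inter_class_orthogonal 4 plan"
proof -
  let ?E = "effects_of_interest plan"
  define \<kappa> where "\<kappa> e = class_vec ` e" for e
  define cls where "cls e = {f \<in> ?E. \<kappa> f = \<kappa> e}" for e
  have eff: "\<exists>a. e = effect a" if "e \<in> ?E" for e
    using that by (auto simp: effects_of_interest_def main_effects_def two_factor_interactions_def)
  have part: "partition_on ?E (cls ` ?E)"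
    by (rule partition_onI) (auto simp: cls_def disjnt_def)
  have main: "effect (vec5 a) \<in> ?E"
    if "a \<in> set (List.n_lists 5 [0, 1, 2])" "length (filter ((\<noteq>) 0) a) = 1" "i < 4"
      "(ldot a (initial_runs ! i) - ldot a (initial_runs ! 0)) mod 3 \<noteq> 0" for a i
    using that card_support_vec5[OF that(1)] not_confoundedI[of a i 0]
    by (auto simp: effects_of_interest_def main_effects_def set_n_lists)
  \<comment> \<open>\<open>A\<close> and \<open>E\<close> have functionals (0,1) and (1,0), which
    are not proportional, and so witness two classes. Initial runs 2 and 1 differ from run 0 in the
    level of \<open>A\<close> and of \<open>E\<close> respectively.\<close>
  have A: "effect (vec5 [1,0,0,0,0]) \<in> ?E"
    by (rule main[where i = 2]) (simp_all add: set_n_lists ldot_def initial_runs_def)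
  have E: "effect (vec5 [0,0,0,0,1]) \<in> ?E"
    by (rule main[where i = 1]) (simp_all add: set_n_lists ldot_def initial_runs_def)
  have "class_vec ` effect (vec5 [1,0,0,0,0]) \<noteq> class_vec ` effect (vec5 [0,0,0,0,1])"
    by (simp add: doubleton_eq_iff class_vec_effect class_vec_vec5 int_class_vec_def ldot_def dir1_def dir2_def)
  then have "\<kappa> (effect (vec5 [1,0,0,0,0])) \<noteq> \<kappa> (effect (vec5 [0,0,0,0,1]))"
    by (simp add: \<kappa>_def)
  then have "cls (effect (vec5 [1,0,0,0,0])) \<noteq> cls (effect (vec5 [0,0,0,0,1]))"
    using A by (auto simp: cls_def)
  moreover have "card {cls (effect (vec5 [1,0,0,0,0])), cls (effect (vec5 [0,0,0,0,1]))} \<le> card (cls ` ?E)"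
    using A E by (intro card_mono) auto
  ultimately have "2 \<le> card (cls ` ?E)" by simp
  moreover have "orthogonal_through_blocks 4 plan e f"
    if XY: "X \<in> cls ` ?E" "Y \<in> cls ` ?E" "X \<noteq> Y" and ef: "e \<in> X" "f \<in> Y" for X Y e f
  proof -
    have "\<kappa> e \<noteq> \<kappa> f" "e \<in> ?E" "f \<in> ?E"
      using XY ef by (auto simp: cls_def)
    moreover from this obtain a b where "e = effect a" "f = effect b"
      using eff by metis
    ultimately show ?thesis
      using orthogonal_if_class_vecs_differ by (simp add: \<kappa>_def)
  qed
  ultimately show ?thesis
    using part unfolding inter_class_orthogonal_def by (intro exI[of _ "cls ` ?E"]) simp
qed

theorem theorem5p3:
  "\<exists>P :: 5 plan.
     length P = 18 \<and> (\<forall>B\<in>set P. length B = 4) \<and>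
     inter_class_orthogonal 4 P \<and>
     confounded P DE2 \<and>
     estimates P (main_effects \<union> two_factor_interactions - {DE2})"
proof (intro exI[of _ plan] conjI)
  show "\<forall>B\<in>set plan. length B = 4"
    by (auto simp: in_set_conv_nth)
  show "estimates plan (main_effects \<union> two_factor_interactions - {DE2})"
    by (rule estimates_plan) (use effects_exhaust in auto)
qed (simp_all add: inter_class_orthogonal_plan confounded_DE2)

end
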